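(* Let $\lambda$ be a nonzero real number and let $Y$ be the Bernoulli random variable with parameter $p$, $0<p\le 1$, i.e. $P\{Y=1\}=p$, $P\{Y=0\}=1-p$. Then, for all integers $n\ge k\ge 0$, $$S_{2}^{Y}(n,k)=p^{k}S_{2}(n,k),\qquad S_{1}^{Y}(n,k)=\frac{1}{p^{n}}S_{1}(n,k),$$ $$S_{2,\lambda}^{Y}(n,k)=p^{k}S_{2,\lambda}(n,k),\qquad S_{1,\lambda}^{Y}(n,k)=\frac{1}{p^{n}}S_{1,\lambda}(n,k).$$
   Context: Classical notions. $S_2(n,k)$ and $S_1(n,k)$ are the Stirling numbers of the second kind and the (signed) Stirling numbers of the first kind: $\frac{1}{k!}(e^t-1)^k=\sum_{n\ge k}S_2(n,k)\frac{t^n}{n!}$, $\frac{1}{k!}(\log(1+t))^k=\sum_{n\ge k}S_1(n,k)\frac{t^n}{n!}$. For nonzero real $\lambda$: $(x)_{0,\lambda}=1$, $(x)_{n,\lambda}=x(x-\lambda)\cdots(x-(n-1)\lambda)$; $e_\lambda^x(t)=(1+\lambda t)^{x/\lambda}=\sum_{n\ge0}(x)_{n,\lambda}\frac{t^n}{n!}$, $e_\lambda(t)=e_\lambda^1(t)$; $\log_\lambda(t)=\frac1\lambda(t^\lambda-1)$. The degenerate Stirling numbers of the second and first kind are defined by $\frac{1}{k!}(e_\lambda(t)-1)^k=\sum_{n\ge k}S_{2,\lambda}(n,k)\frac{t^n}{n!}$ and $\frac{1}{k!}(\log_\lambda(1+t))^k=\sum_{n\ge k}S_{1,\lambda}(n,k)\frac{t^n}{n!}$.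 Probabilistic versions. For a random variable $Y$ whose moment generating function exists near $0$ and with $E[Y]\ne0$, put $e_Y(t)=E[e^{Yt}]-1=\sum_{n\ge1}E[Y^n]\frac{t^n}{n!}$ and $e_{Y,\lambda}(t)=E[e_\lambda^Y(t)]-1=\sum_{n\ge1}E[(Y)_{n,\lambda}]\frac{t^n}{n!}$ (power series in $t$), and let $\bar e_Y(t)$, $\bar e_{Y,\lambda}(t)$ be their compositional inverses. Then for $k\ge0$: $\frac{1}{k!}(e_Y(t))^k=\sum_{n\ge k}S_2^Y(n,k)\frac{t^n}{n!}$, $\frac{1}{k!}(\bar e_Y(t))^k=\sum_{n\ge k}S_1^Y(n,k)\frac{t^n}{n!}$, $\frac{1}{k!}(e_{Y,\lambda}(t))^k=\sum_{n\ge k}S_{2,\lambda}^Y(n,k)\frac{t^n}{n!}$, $\frac{1}{k!}(\bar e_{Y,\lambda}(t))^k=\sum_{n\ge k}S_{1,\lambda}^Y(n,k)\frac{t^n}{n!}$ define the probabilistic (degenerate) Stirling numbers associated with $Y$. *)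

theory Defs
  imports
    "HOL-Probability.Probability"
    "HOL-Computational_Algebra.Formal_Power_Series"
    "HOL-Combinatorics.Stirling"
begin

unbundle no vec_syntax
unbundle fps_syntax

text \<open>
  All Stirling numbers below arise from a power series \<open>f\<close> without constant term by
  \<open>f ^ k / k! = (\<Sum>n\<ge>k. S(n, k) * t ^ n / n!)\<close>.
\<close>

definition egf_stirling :: "real fps \<Rightarrow> nat \<Rightarrow> nat \<Rightarrow> real" where
  "egf_stirling f n k = fact n * (fps_const (1 / fact k) * f ^ k) $ n"

definition S2 :: "nat \<Rightarrow> nat \<Rightarrow> real" where
  "S2 = egf_stirling (fps_exp 1 - 1)"

text \<open>\<^term>\<open>fps_ln 1\<close> is the series of \<open>log (1 + t)\<close>.\<close>

definition S1 :: "nat \<Rightarrow> nat \<Rightarrow> real" where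
  "S1 = egf_stirling (fps_ln 1)"

text \<open>The series \<open>e\<^sub>\<lambda>\<^sup>x(t) = (1 + \<lambda> t) powr (x / \<lambda>)\<close>, for \<open>\<lambda> \<noteq> 0\<close>.\<close>

definition deg_exp :: "real \<Rightarrow> real \<Rightarrow> real fps" where
  "deg_exp l x = fps_binomial (x / l) oo (fps_const l * fps_X)"

text \<open>The series \<open>log\<^sub>\<lambda>(1 + t) = ((1 + t) powr \<lambda> - 1) / \<lambda>\<close>, for \<open>\<lambda> \<noteq> 0\<close>.\<close>

definition deg_ln :: "real \<Rightarrow> real fps" where
  "deg_ln l = fps_const (1 / l) * (fps_binomial l - 1)"

definition S2_deg :: "real \<Rightarrow> nat \<Rightarrow> nat \<Rightarrow> real" where
  "S2_deg l = egf_stirling (deg_exp l 1 - 1)"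

definition S1_deg :: "real \<Rightarrow> nat \<Rightarrow> nat \<Rightarrow> real" where
  "S1_deg l = egf_stirling (deg_ln l)"

text \<open>
  The expectation of a random power series is taken coefficientwise, as in
  \<open>E[e\<^sup>Y\<^sup>t] = (\<Sum>n. E[Y ^ n] * t ^ n / n!)\<close>.
\<close>

definition fps_expectation :: "'a measure \<Rightarrow> ('a \<Rightarrow> real fps) \<Rightarrow> real fps" where
  "fps_expectation M F = Abs_fps (\<lambda>n. \<integral>\<omega>. F \<omega> $ n \<partial>M)"

definition e_prob :: "'a measure \<Rightarrow> ('a \<Rightarrow> real) \<Rightarrow> real fps" where
  "e_prob M Y = fps_expectation M (\<lambda>\<omega>. fps_exp (Y \<omega>)) - 1"

definition e_prob_deg :: "'a measure \<Rightarrow> ('a \<Rightarrow> real) \<Rightarrow> real \<Rightarrow> real fps" where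
  "e_prob_deg M Y l = fps_expectation M (\<lambda>\<omega>. deg_exp l (Y \<omega>)) - 1"

text \<open>
  The definitions below are meaningful if \<open>Y\<close> is a random variable on the probability space \<open>M\<close>
  with moment generating function near \<open>0\<close> and nonzero mean. Then both series above have
  constant term \<open>0\<close> and linear coefficient \<open>E[Y] \<noteq> 0\<close>, so \<^const>\<open>fps_inv\<close>
  is the compositional inverse.
\<close>

definition S2_prob :: "'a measure \<Rightarrow> ('a \<Rightarrow> real) \<Rightarrow> nat \<Rightarrow> nat \<Rightarrow> real" where
  "S2_prob M Y = egf_stirling (e_prob M Y)"

definition S1_prob :: "'a measure \<Rightarrow> ('a \<Rightarrow> real) \<Rightarrow> nat \<Rightarrow> nat \<Rightarrow> real" where
  "S1_prob M Y = egf_stirling (fps_inv (e_prob M Y))"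

definition S2_prob_deg :: "'a measure \<Rightarrow> ('a \<Rightarrow> real) \<Rightarrow> real \<Rightarrow> nat \<Rightarrow> nat \<Rightarrow> real" where
  "S2_prob_deg M Y l = egf_stirling (e_prob_deg M Y l)"

definition S1_prob_deg :: "'a measure \<Rightarrow> ('a \<Rightarrow> real) \<Rightarrow> real \<Rightarrow> nat \<Rightarrow> nat \<Rightarrow> real" where
  "S1_prob_deg M Y l = egf_stirling (fps_inv (e_prob_deg M Y l))"

lemma deg_exp_nth:
  assumes "l \<noteq> 0"
  shows "deg_exp l x $ n = (\<Prod>i<n. x - of_nat i * l) / fact n"
proof -
  have "l ^ n * (\<Prod>i<n. x / l - of_nat i) = (\<Prod>i<n. x - of_nat i * l)"
    using assms by (induction n) (simp_all add: field_simps)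
  then show ?thesis
    by (simp add: deg_exp_def fps_compose_linear gbinomial_prod_rev atLeast0LessThan)
qed

lemma (in prob_space) e_prob_nth:
  "e_prob M Y $ n = (if n = 0 then 0 else expectation (\<lambda>\<omega>. Y \<omega> ^ n) / fact n)"
  by (simp add: e_prob_def fps_expectation_def prob_space)

lemma (in prob_space) e_prob_deg_nth:
  assumes "l \<noteq> 0"
  shows "e_prob_deg M Y l $ n =
    (if n = 0 then 0 else expectation (\<lambda>\<omega>. \<Prod>i<n. Y \<omega> - of_nat i * l) / fact n)"
  using assms by (simp add: e_prob_deg_def fps_expectation_def deg_exp_nth prob_space)

lemma egf_stirling_0_right: "egf_stirling f n 0 = (if n = 0 then 1 else 0)"
  by (simp add: egf_stirling_def)

lemma egf_stirling_0_left: "f $ 0 = 0 \<Longrightarrow> egf_stirling f 0 (Suc k) = 0"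
  by (simp add: egf_stirling_def)

lemma egf_stirling_Suc_Suc:
  "egf_stirling f (Suc n) (Suc k) =
     fact n * (fps_const (1 / fact k) * f ^ k * fps_deriv f) $ n"
proof -
  have "fps_deriv (fps_const (1 / fact (Suc k)) * f ^ Suc k) =
        fps_const (1 / fact k) * f ^ k * fps_deriv f"
  proof -
    have "fps_const (1 / fact (Suc k)) * fps_const (real (Suc k)) = fps_const (1 / fact k)"
      by (simp del: of_nat_Suc)
    then show ?thesis
      unfolding fps_deriv_mult fps_deriv_power
      by (simp add: mult_ac del: of_nat_Suc fact_Suc power_Suc fps_const_mult)
  qed
  then have "(fps_const (1 / fact k) * f ^ k * fps_deriv f) $ n =
      real (Suc n) * (fps_const (1 / fact (Suc k)) * f ^ Suc k) $ Suc n"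
    by (metis fps_deriv_nth Suc_eq_plus1)
  then show ?thesis by (simp add: egf_stirling_def)
qed

lemma S2_eq_Stirling: "S2 n k = real (Stirling n k)"
proof (induction n arbitrary: k)
  case 0
  then show ?case by (cases k) (simp_all add: S2_def egf_stirling_0_right egf_stirling_0_left)
next
  case (Suc n)
  show ?case
  proof (cases k)
    case 0
    then show ?thesis by (simp add: S2_def egf_stirling_0_right)
  next
    case (Suc j)
    define f where "f = fps_exp (1::real) - 1"
    have d: "fps_deriv f = f + 1" by (simp add: f_def)
    have c: "fps_const (1 / fact j) = fps_const (real (Suc j)) * fps_const (1 / fact (Suc j))"
      by (simp del: of_nat_Suc)
    have "fps_const (1 / fact j) * f ^ j * fps_deriv f =
        fps_const (1 / fact j) * f ^ j + fps_const (1 / fact j) * f ^ Suc j"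
      by (simp add: d algebra_simps)
    also have "fps_const (1 / fact j) * f ^ Suc j =
        fps_const (real (Suc j)) * (fps_const (1 / fact (Suc j)) * f ^ Suc j)"
      by (simp only: c mult.assoc)
    finally have *: "fps_const (1 / fact j) * f ^ j * fps_deriv f =
        fps_const (1 / fact j) * f ^ j +
        fps_const (real (Suc j)) * (fps_const (1 / fact (Suc j)) * f ^ Suc j)" .
    have "S2 (Suc n) (Suc j) = real (Suc j) * S2 n (Suc j) + S2 n j"
      unfolding S2_def f_def[symmetric] egf_stirling_Suc_Suc *
      unfolding egf_stirling_def fps_add_nth fps_mult_left_const_nth
      by (simp add: distrib_left)
    then show ?thesis by (simp add: Suc Suc.IH algebra_simps)
  qed
qed

lemma S1_eq_stirling: "S1 n k = (-1) ^ (n + k) * real (stirling n k)"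
proof (induction n arbitrary: k)
  case 0
  then show ?case by (cases k) (simp_all add: S1_def egf_stirling_0_right egf_stirling_0_left fps_ln_def)
next
  case (Suc n)
  show ?case
  proof (cases k)
    case 0
    then show ?thesis by (simp add: S1_def egf_stirling_0_right)
  next
    case (Suc j)
    define g where "g = fps_const (1 / fact j) * fps_ln (1::real) ^ j * fps_deriv (fps_ln 1)"
    have d: "(1 + fps_X) * fps_deriv (fps_ln 1) = (1 :: real fps)"
      by (subst fps_ln_deriv) (simp_all add: inverse_mult_eq_1')
    have r: "S1 (Suc m) (Suc j) = fact m * g $ m" for m
      by (simp only: S1_def egf_stirling_Suc_Suc g_def)
    have "fps_const (1 / fact j) * fps_ln 1 ^ j = (1 + fps_X) * g"
      using d by (simp add: g_def mult_ac)
    then have e: "(fps_const (1 / fact j) * fps_ln 1 ^ j) $ n = g $ n + (if n = 0 then 0 else g $ (n - 1))"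
      by (simp add: algebra_simps)
    have "S1 n j = S1 (Suc n) (Suc j) + real n * S1 n (Suc j)"
    proof (cases n)
      case 0
      then show ?thesis using e r[of 0]
        by (simp add: S1_def egf_stirling_def)
    next
      case (Suc m)
      have "S1 n j = fact n * (fps_const (1 / fact j) * fps_ln 1 ^ j) $ n"
        by (simp add: S1_def egf_stirling_def)
      then show ?thesis unfolding e r using Suc
        by (simp add: r distrib_left)
    qed
    then show ?thesis by (simp add: Suc Suc.IH algebra_simps)
  qed
qed

end

theory Submission
  imports Defs
begin

text \<open>
  A Bernoulli variable takes only the values \<open>0\<close> and \<open>1\<close>. Hence, for any
  measurable family of power series \<open>F\<close> with \<open>F 0 = 1\<close>, we have
  \<open>E[F Y] - 1 = p (F 1 - 1)\<close>. With \<open>F x = e\<^sup>x\<^sup>t\<close> and \<open>F x = e\<^sub>\<lambda>\<^sup>x(t)\<close>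
  this says that the two probabilistic exponential series are \<open>p\<close> times the series
  \<open>e\<^sup>t - 1\<close> and \<open>e\<^sub>\<lambda>(t) - 1\<close> that define the non-probabilistic Stirling numbers.

  The factor \<open>p\<close> in front of a series \<open>f\<close> becomes \<open>p\<^sup>k\<close> in
  \<open>f\<^sup>k\<close>, which settles the numbers of the second kind. Passing to compositional inverses
  turns it into the substitution \<open>t \<mapsto> t/p\<close>, which multiplies the coefficient of
  \<open>t\<^sup>n\<close> by \<open>1/p\<^sup>n\<close>; this settles the numbers of the first kind, once it is
  known that \<open>log(1 + t)\<close> and \<open>log\<^sub>\<lambda>(1 + t)\<close> are the inverses of
  \<open>e\<^sup>t - 1\<close> and \<open>e\<^sub>\<lambda>(t) - 1\<close>. The degenerate case of the latter rests on
  the formal power law \<open>((1 + t)\<^sup>b)\<^sup>a = (1 + t)\<^bsup>ab\<^esup>\<close>.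
\<close>

lemma egf_stirling_const_mult:
  "egf_stirling (fps_const c * f) n k = c ^ k * egf_stirling f n k"
  by (simp add: egf_stirling_def power_mult_distrib fps_const_power mult.left_commute)

lemma egf_stirling_compose_linear:
  "egf_stirling (f oo (fps_const c * fps_X)) n k = c ^ n * egf_stirling f n k"
  by (simp add: egf_stirling_def fps_compose_power)

lemma fps_inv_unique:
  fixes f g :: "'a::field fps"
  assumes "f $ 0 = 0" "f $ 1 \<noteq> 0" "g oo f = fps_X"
  shows "fps_inv f = g"
  using assms fps_inv[of f] fps_compose_inj_right[of f "fps_inv f" g] by simp

text \<open>Solving \<open>c f(s) = t\<close> for \<open>s\<close> means solving \<open>f(s) = t/c\<close>.\<close>

lemma fps_inv_const_mult:
  fixes f :: "'a::field fps"
  assumes "f $ 0 = 0" "f $ 1 \<noteq> 0" "c \<noteq> 0"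
  shows "fps_inv (fps_const c * f) = fps_inv f oo (fps_const (1 / c) * fps_X)"
proof (rule fps_inv_unique)
  have "(fps_const (1 / c) * fps_X) oo (fps_const c * f) = fps_const (1 / c) * (fps_const c * f)"
    using assms by (simp flip: fps_const_mult_apply_left)
  also have "\<dots> = f"
    using assms by (simp flip: mult.assoc)
  finally have "(fps_const (1 / c) * fps_X) oo (fps_const c * f) = f" .
  then show "fps_inv f oo (fps_const (1 / c) * fps_X) oo (fps_const c * f) = fps_X"
    using assms by (simp add: fps_inv flip: fps_compose_assoc)
qed (use assms in simp_all)

text \<open>
  This is \<open>((1 + t)\<^sup>b)\<^sup>a = (1 + t)\<^bsup>ab\<^esup>\<close>: since \<^term>\<open>fps_binomial a\<close> is
  a series in the deviation of its base from \<open>1\<close>, substituting \<open>(1 + t)\<^sup>b\<close> for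
  the base is composition with \<open>(1 + t)\<^sup>b - 1\<close>. By the chain rule the composition
  solves \<open>(1 + t) y' = a b y\<close>, \<open>y(0) = 1\<close>, which characterises the right-hand side.
\<close>

lemma fps_binomial_compose:
  fixes a b :: "'a::field_char_0"
  shows "fps_binomial a oo (fps_binomial b - 1) = fps_binomial (a * b)"
proof -
  define g where "g = fps_binomial b - 1"
  define h where "h = fps_binomial a oo g"
  have g0: "g $ 0 = 0" by (simp add: g_def)
  have "(1 + fps_X) oo g = fps_binomial b"
    using g0 by (simp add: fps_compose_add_distrib) (simp add: g_def)
  then have "fps_deriv (fps_binomial a) oo g = fps_const a * h / fps_binomial b"
    using g0 by (simp add: fps_binomial_deriv fps_divide_compose fps_compose_mult_distrib h_def)
  then have "fps_deriv h = fps_const a * h / fps_binomial b * (fps_const b * fps_binomial b / (1 + fps_X))"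
    using g0 by (simp add: h_def fps_compose_deriv) (simp add: g_def fps_binomial_deriv)
  also have "\<dots> = fps_const (a * b) * h * (inverse (fps_binomial b) * fps_binomial b) / (1 + fps_X)"
    by (simp add: fps_divide_unit mult_ac flip: fps_const_mult)
  also have "\<dots> = fps_const (a * b) * h / (1 + fps_X)"
    by (subst inverse_mult_eq_1) simp_all
  finally have "fps_deriv h = fps_const (a * b) * h / (1 + fps_X)" .
  moreover have "h $ 0 = 1" by (simp add: h_def)
  ultimately show ?thesis
    unfolding h_def g_def by (simp flip: fps_binomial_ODE_unique')
qed

text \<open>
  Up to scaling the variable by \<open>\<lambda>\<close>, the series \<open>e\<^sub>\<lambda>(t)\<close> is
  \<open>(1 + t)\<^bsup>1/\<lambda>\<^esup>\<close>. Raising it to the power \<open>\<lambda>\<close>, as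
  \<open>log\<^sub>\<lambda>\<close> does, gives \<open>1 + t\<close> by the power law, and the factor
  \<open>1/\<lambda>\<close> in \<open>log\<^sub>\<lambda>\<close> undoes the scaling.
\<close>

lemma fps_inv_deg_exp:
  assumes "l \<noteq> 0"
  shows "fps_inv (deg_exp l 1 - 1) = deg_ln l"
proof (rule fps_inv_unique)
  define g where "g = fps_binomial (1 / l) - 1"
  have g0: "g $ 0 = 0" by (simp add: g_def)
  have "fps_binomial l oo g = 1 + fps_X"
    using assms by (simp add: g_def fps_binomial_compose fps_binomial_1)
  then have "deg_ln l oo g = fps_const (1 / l) * fps_X"
    by (simp add: deg_ln_def fps_compose_sub_distrib flip: fps_const_mult_apply_left)
  moreover have "deg_exp l 1 - 1 = g oo (fps_const l * fps_X)"
    by (simp add: deg_exp_def g_def fps_compose_sub_distrib)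
  ultimately have "deg_ln l oo (deg_exp l 1 - 1) = (fps_const (1 / l) * fps_X) oo (fps_const l * fps_X)"
    using g0 by (simp add: fps_compose_assoc)
  also have "\<dots> = fps_X"
    using assms by (simp flip: fps_const_mult_apply_left mult.assoc)
  finally show "deg_ln l oo (deg_exp l 1 - 1) = fps_X" .
qed (use assms in \<open>simp_all add: deg_exp_nth\<close>)

lemma deg_exp_0: "deg_exp l 0 = 1"
  by (simp add: deg_exp_def)

text \<open>
  The two masses \<open>p\<close> and \<open>1 - p\<close> add up to \<open>1\<close>, so almost surely
  \<open>Y\<close> is \<open>0\<close> or \<open>1\<close>, and \<open>g(Y)\<close> is almost surely a
  combination of two indicators.
\<close>

lemma (in prob_space) expectation_bernoulli:
  fixes g :: "real \<Rightarrow> real"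
  assumes Y [measurable]: "Y \<in> borel_measurable M"
    and [measurable]: "g \<in> borel_measurable borel"
    and 1: "prob {\<omega> \<in> space M. Y \<omega> = 1} = p"
    and 0: "prob {\<omega> \<in> space M. Y \<omega> = 0} = 1 - p"
  shows "expectation (\<lambda>\<omega>. g (Y \<omega>)) = p * g 1 + (1 - p) * g 0"
proof -
  define A where "A = {\<omega> \<in> space M. Y \<omega> = 1}"
  define B where "B = {\<omega> \<in> space M. Y \<omega> = 0}"
  have [measurable]: "A \<in> events" "B \<in> events"
    by (simp_all add: A_def B_def)
  have "prob (A \<union> B) = prob A + prob B"
    by (rule finite_measure_Union) (auto simp: A_def B_def)
  then have "prob (A \<union> B) = 1"
    using 1 0 by (simp add: A_def B_def)
  then have "AE \<omega> in M. \<omega> \<in> A \<union> B"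
    by (subst (asm) prob_eq_1) simp_all
  then have ae: "AE \<omega> in M. g (Y \<omega>) = g 1 * indicator A \<omega> + g 0 * indicator B \<omega>"
    by eventually_elim (auto simp: A_def B_def)
  have "expectation (\<lambda>\<omega>. g (Y \<omega>)) = expectation (\<lambda>\<omega>. g 1 * indicator A \<omega> + g 0 * indicator B \<omega>)"
    by (rule integral_cong_AE) (use ae in simp_all)
  also have "\<dots> = g 1 * prob A + g 0 * prob B"
    by (simp add: emeasure_eq_measure)
  finally show ?thesis
    using 1 0 by (simp add: A_def B_def mult.commute)
qed

text \<open>
  Coefficientwise, \<open>E[F Y] = p F 1 + (1 - p) F 0\<close>; because \<open>F 0 = 1\<close>, the
  constant \<open>1\<close> subtracted on the left is absorbed.
\<close>

lemma (in prob_space) fps_expectation_bernoulli: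
  fixes F :: "real \<Rightarrow> real fps"
  assumes "\<And>n. (\<lambda>x. F x $ n) \<in> borel_measurable borel" "F 0 = 1"
    and "Y \<in> borel_measurable M"
    and "prob {\<omega> \<in> space M. Y \<omega> = 1} = p"
    and "prob {\<omega> \<in> space M. Y \<omega> = 0} = 1 - p"
  shows "fps_expectation M (\<lambda>\<omega>. F (Y \<omega>)) - 1 = fps_const p * (F 1 - 1)"
proof (rule fps_ext)
  fix n
  show "(fps_expectation M (\<lambda>\<omega>. F (Y \<omega>)) - 1) $ n = (fps_const p * (F 1 - 1)) $ n"
    using expectation_bernoulli[where g = "\<lambda>x. F x $ n", OF assms(3,1,4,5)]
    by (cases "n = 0") (simp_all add: fps_expectation_def assms(2) algebra_simps)
qed

theorem theorem2p1:
  fixes M :: "'a measure" and Y :: "'a \<Rightarrow> real" and p l :: real and n k :: nat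
  assumes "prob_space M"
    and "Y \<in> borel_measurable M"
    and "0 < p" and "p \<le> 1"
    and "measure M {\<omega> \<in> space M. Y \<omega> = 1} = p"
    and "measure M {\<omega> \<in> space M. Y \<omega> = 0} = 1 - p"
    and "l \<noteq> 0"
    and "k \<le> n"
  shows "S2_prob M Y n k = p ^ k * S2 n k \<and>
         S1_prob M Y n k = 1 / p ^ n * S1 n k \<and>
         S2_prob_deg M Y l n k = p ^ k * S2_deg l n k \<and>
         S1_prob_deg M Y l n k = 1 / p ^ n * S1_deg l n k"
proof -
  interpret prob_space M by fact
  let ?f = "fps_exp (1::real) - 1" and ?d = "deg_exp l 1 - 1"
  have e: "e_prob M Y = fps_const p * ?f"
    unfolding e_prob_def using assms by (intro fps_expectation_bernoulli) simp_all
  have ed: "e_prob_deg M Y l = fps_const p * ?d"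
    unfolding e_prob_deg_def using assms
    by (intro fps_expectation_bernoulli) (simp_all add: deg_exp_nth deg_exp_0)
  have "fps_inv (e_prob M Y) = fps_ln 1 oo (fps_const (1 / p) * fps_X)"
    unfolding e using \<open>0 < p\<close> by (subst fps_inv_const_mult) (simp_all add: fps_ln_fps_exp_inv)
  moreover have "fps_inv (e_prob_deg M Y l) = deg_ln l oo (fps_const (1 / p) * fps_X)"
    unfolding ed using \<open>0 < p\<close> \<open>l \<noteq> 0\<close>
    by (subst fps_inv_const_mult) (simp_all add: deg_exp_nth fps_inv_deg_exp)
  ultimately show ?thesis
    unfolding S2_prob_def S1_prob_def S2_prob_deg_def S1_prob_deg_def
      S2_def S1_def S2_deg_def S1_deg_def e ed
    by (simp only: egf_stirling_const_mult egf_stirling_compose_linear power_one_over simp_thms)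
qed

end
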